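(* Let $p$ be an odd prime and let $\mathbf{u} = (u_1,u_2,u_3) \in \mathbb{N}^3$ be a solution to $$\frac{4}{p} = \frac{1}{u_1} + \frac{1}{u_2} + \frac{1}{u_3}.$$ Then there exist $i \neq j$ in $\{1,2,3\}$ such that $u_i/u_j \in \mathbb{Z}_p^*$. Moreover, for any such $i \neq j$ we have $$\left(\frac{-u_i/u_j}{p}\right) = -1.$$
   Context: $\mathbb{N}$ denotes the positive integers. $\left(\frac{\cdot}{p}\right)$ is the Legendre symbol, applied to an element of $\mathbb{Z}_p^*$ via its reduction modulo $p$. *)

theory Defs
  imports "HOL-Number_Theory.Number_Theory"
begin

text \<open>
  The ring of \<open>p\<close>-adic integers as the inverse limit of the rings \<open>\<int>/p\<^sup>n\<int>\<close>: an element is the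
  coherent sequence of its residues, the \<open>n\<close>-th one represented in \<open>{0..<p ^ n}\<close>.
\<close>

definition padic_int :: "nat \<Rightarrow> (nat \<Rightarrow> int) ring" where
  "padic_int p =
    \<lparr>carrier = {x. \<forall>n. x n \<in> {0..<int p ^ n} \<and> x (Suc n) mod int p ^ n = x n},
     mult = (\<lambda>x y n. (x n * y n) mod int p ^ n),
     one = (\<lambda>n. 1 mod int p ^ n),
     zero = (\<lambda>n. 0),
     add = (\<lambda>x y n. (x n + y n) mod int p ^ n)\<rparr>"

definition padic_of_int :: "nat \<Rightarrow> int \<Rightarrow> nat \<Rightarrow> int" where
  "padic_of_int p a = (\<lambda>n. a mod int p ^ n)"

text \<open>
  The fraction \<open>a / b\<close> of \<open>\<rat> \<subseteq> \<rat>\<^sub>p\<close> lies in \<open>\<int>\<^sub>p\<close> and is equal to \<open>x\<close>. The field \<open>\<rat>\<^sub>p\<close> is avoided by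
  clearing the denominator; \<open>x\<close> is determined by \<open>a\<close> and \<open>b\<close> if \<open>b \<noteq> 0\<close>, see
  \<open>padic_is_quotient_unique\<close> below.
\<close>

definition padic_is_quotient :: "nat \<Rightarrow> (nat \<Rightarrow> int) \<Rightarrow> int \<Rightarrow> int \<Rightarrow> bool" where
  "padic_is_quotient p x a b \<longleftrightarrow>
     x \<in> carrier (padic_int p) \<and>
     padic_of_int p b \<otimes>\<^bsub>padic_int p\<^esub> x = padic_of_int p a"

text \<open>Reduction \<open>\<int>\<^sub>p \<rightarrow> \<int>/p\<int>\<close>, with values in \<open>{0..<p}\<close>.\<close>

definition padic_reduce :: "(nat \<Rightarrow> int) \<Rightarrow> int" where
  "padic_reduce x = x 1"

lemma padic_of_int_carrier:
  assumes "p > 0"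
  shows "padic_of_int p a \<in> carrier (padic_int p)"
  using assms by (auto simp: padic_int_def padic_of_int_def mod_mod_cancel)

lemma padic_int_mod_Suc: "(a mod int p ^ Suc n) mod int p ^ n = a mod int p ^ n"
  by (rule mod_mod_cancel) simp

lemma padic_int_cring:
  assumes "p > 0"
  shows "cring (padic_int p)"
proof (rule cringI)
  show "abelian_group (padic_int p)"
  proof (rule abelian_groupI)
    fix x y assume "x \<in> carrier (padic_int p)" "y \<in> carrier (padic_int p)"
    then have "\<And>n. x (Suc n) mod int p ^ n = x n" "\<And>n. y (Suc n) mod int p ^ n = y n"
      by (auto simp: padic_int_def)
    then have "(x (Suc n) + y (Suc n)) mod int p ^ n = (x n + y n) mod int p ^ n" for n
      by (metis mod_add_eq)
    then show "x \<oplus>\<^bsub>padic_int p\<^esub> y \<in> carrier (padic_int p)"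
      using assms padic_int_mod_Suc[of _ p] by (simp add: padic_int_def del: power_Suc)
  next
    show "\<zero>\<^bsub>padic_int p\<^esub> \<in> carrier (padic_int p)"
      using assms by (simp add: padic_int_def)
  next
    fix x assume x: "x \<in> carrier (padic_int p)"
    define y where "y = (\<lambda>n. (- x n) mod int p ^ n)"
    have "(- x (Suc n)) mod int p ^ n = (- x n) mod int p ^ n" for n
      using x by (metis (mono_tags, lifting) mod_minus_eq padic_int_def mem_Collect_eq
          partial_object.select_convs(1))
    then have "y \<in> carrier (padic_int p)"
      using assms padic_int_mod_Suc[of _ p] by (simp add: padic_int_def y_def del: power_Suc)
    moreover have "y \<oplus>\<^bsub>padic_int p\<^esub> x = \<zero>\<^bsub>padic_int p\<^esub>"
      by (simp add: padic_int_def y_def mod_add_left_eq)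
    ultimately show "\<exists>y\<in>carrier (padic_int p). y \<oplus>\<^bsub>padic_int p\<^esub> x = \<zero>\<^bsub>padic_int p\<^esub>"
      by blast
  qed (auto simp: padic_int_def mod_simps algebra_simps)
  show "comm_monoid (padic_int p)"
  proof (rule comm_monoidI)
    fix x y assume "x \<in> carrier (padic_int p)" "y \<in> carrier (padic_int p)"
    then have "\<And>n. x (Suc n) mod int p ^ n = x n" "\<And>n. y (Suc n) mod int p ^ n = y n"
      by (auto simp: padic_int_def)
    then have "(x (Suc n) * y (Suc n)) mod int p ^ n = (x n * y n) mod int p ^ n" for n
      by (metis mod_mult_eq)
    then show "x \<otimes>\<^bsub>padic_int p\<^esub> y \<in> carrier (padic_int p)"
      using assms padic_int_mod_Suc[of _ p] by (simp add: padic_int_def del: power_Suc)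
  next
    show "\<one>\<^bsub>padic_int p\<^esub> \<in> carrier (padic_int p)"
      using padic_of_int_carrier[OF assms, of 1] by (simp add: padic_int_def padic_of_int_def)
  qed (auto simp: padic_int_def mod_simps algebra_simps)
qed (auto simp: padic_int_def mod_simps algebra_simps)

lemma padic_is_quotient_unique:
  assumes "prime p" and "b \<noteq> 0"
    and "padic_is_quotient p x a b" and "padic_is_quotient p y a b"
  shows "x = y"
proof
  fix n
  have p: "prime (int p)" using assms(1) by simp
  define v where "v = multiplicity (int p) b"
  obtain c where c: "b = int p ^ v * c" "\<not> int p dvd c"
    using multiplicity_decompose'[of b "int p"] assms(2) p v_def
    by (metis not_prime_unit)
  have red: "z (n + k) mod int p ^ n = z n" if "z \<in> carrier (padic_int p)" for z k
  proof (induction k)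
    case 0
    then show ?case using that by (auto simp: padic_int_def)
  next
    case (Suc k)
    have "z (Suc (n + k)) mod int p ^ (n + k) = z (n + k)"
      using that by (auto simp: padic_int_def)
    then have "z (n + k) mod int p ^ n = z (Suc (n + k)) mod int p ^ n"
      by (metis mod_mod_cancel le_imp_power_dvd le_add1)
    then show ?case using Suc by simp
  qed
  have xy: "x \<in> carrier (padic_int p)" "y \<in> carrier (padic_int p)"
    using assms(3,4) by (auto simp: padic_is_quotient_def)
  have "padic_of_int p b \<otimes>\<^bsub>padic_int p\<^esub> x = padic_of_int p b \<otimes>\<^bsub>padic_int p\<^esub> y"
    using assms(3,4) by (auto simp: padic_is_quotient_def)
  then have "(padic_of_int p b \<otimes>\<^bsub>padic_int p\<^esub> x) (n + v)
      = (padic_of_int p b \<otimes>\<^bsub>padic_int p\<^esub> y) (n + v)" by simp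
  then have "(b * x (n + v)) mod int p ^ (n + v) = (b * y (n + v)) mod int p ^ (n + v)"
    by (simp add: padic_int_def padic_of_int_def mod_mult_left_eq)
  then have "int p ^ (n + v) dvd b * (x (n + v) - y (n + v))"
    by (simp add: mod_eq_dvd_iff right_diff_distrib)
  then have "int p ^ v * int p ^ n dvd int p ^ v * (c * (x (n + v) - y (n + v)))"
    by (simp add: c(1) power_add mult_ac)
  then have "int p ^ n dvd c * (x (n + v) - y (n + v))"
    using p by (subst (asm) dvd_mult_cancel_left) auto
  moreover have "coprime (int p ^ n) c"
    using c(2) p by (simp add: prime_imp_coprime)
  ultimately have "int p ^ n dvd x (n + v) - y (n + v)"
    by (simp add: coprime_dvd_mult_right_iff)
  then have "x (n + v) mod int p ^ n = y (n + v) mod int p ^ n"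
    by (simp add: mod_eq_dvd_iff)
  then show "x n = y n" using red xy by metis
qed

end

theory Submission
  imports Defs
begin

text \<open>
  Let \<open>u\<^sub>i / u\<^sub>j\<close> be a \<open>p\<close>-adic unit, and write \<open>u\<^sub>i = g * x\<close> and \<open>u\<^sub>j = g * y\<close> with \<open>x\<close> and \<open>y\<close>
  coprime; then \<open>p\<close> divides neither of them. Clearing denominators and cancelling common
  factors gives positive integers \<open>d\<close> and \<open>w\<close> such that \<open>w\<close> divides \<open>x + y\<close> and either
  \<open>p + w = 4 * d * x * y\<close> or \<open>p * w + 1 = 4 * d * x * y\<close>. By quadratic reciprocity the Legendre
  symbol of \<open>- x * y\<close> at odd primes extends to a quadratic character modulo \<open>4 * x * y\<close> with value
  \<open>-1\<close> at \<open>-1\<close>. It is 1 at \<open>w\<close>, because \<open>- x * y\<close> is congruent to \<open>x\<^sup>2\<close> modulo \<open>w\<close>, and so each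
  of the two equations forces the value \<open>-1\<close> at \<open>p\<close>.

  A unit quotient exists because the three \<open>p\<close>-adic valuations cannot be distinct: otherwise the
  equation would force the largest one to be 1 and hence the middle one to be at most 0.
\<close>

subsection \<open>The Legendre symbol\<close>

lemma Legendre_cases: "Legendre a p \<in> {-1, 0, 1}"
  by (simp add: Legendre_def)

lemma Legendre_cong:
  assumes "[a = b] (mod p)"
  shows "Legendre a p = Legendre b p"
proof -
  have "[a = 0] (mod p) \<longleftrightarrow> [b = 0] (mod p)"
    using assms by (metis cong_sym cong_trans)
  moreover have "QuadRes p a \<longleftrightarrow> QuadRes p b"
    unfolding QuadRes_def using assms by (metis cong_sym cong_trans)
  ultimately show ?thesis by (simp add: Legendre_def)
qed

lemma Legendre_square:
  assumes "prime r" "\<not> int r dvd a"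
  shows "Legendre (a\<^sup>2) (int r) = 1"
proof -
  have "\<not> [a\<^sup>2 = 0] (mod int r)"
    using assms by (simp add: cong_0_iff prime_dvd_power_iff)
  moreover have "QuadRes (int r) (a\<^sup>2)"
    unfolding QuadRes_def by (intro exI[of _ a]) simp
  ultimately show ?thesis by (simp add: Legendre_def)
qed

text \<open>Such values differ by at most 2, which is less than \<open>r\<close>. This turns the
  congruences of Euler's criterion into equalities.\<close>

lemma signs_cong_imp_eq:
  fixes a b :: int
  assumes "[a = b] (mod int r)" "r > 2" "a \<in> {-1, 0, 1}" "b \<in> {-1, 0, 1}"
  shows "a = b"
proof -
  have "int r dvd a - b" using assms(1) by (simp add: cong_iff_dvd_diff)
  moreover have "\<bar>a - b\<bar> < int r" using assms(2-4) by auto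
  ultimately show ?thesis using dvd_imp_le_int[of "a - b" "int r"] by auto
qed

lemma prime_odd_gt_2:
  assumes "prime r" "odd (r::nat)"
  shows "r > 2"
  using assms prime_ge_2_nat[of r] by (cases "r = 2") auto

text \<open>By Euler's criterion both sides are congruent to
  \<open>(a * b) ^ ((r - 1) div 2)\<close> modulo \<open>r\<close>.\<close>

lemma Legendre_mult:
  assumes "prime r" "odd r"
  shows "Legendre (a * b) (int r) = Legendre a (int r) * Legendre b (int r)"
proof (rule signs_cong_imp_eq)
  show r: "r > 2" by (rule prime_odd_gt_2[OF assms])
  note e = euler_criterion[OF assms(1) r]
  show "[Legendre (a * b) (int r) = Legendre a (int r) * Legendre b (int r)] (mod int r)"
    using cong_trans[OF e[of "a * b"] cong_sym[OF cong_mult[OF e[of a] e[of b]],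
        folded power_mult_distrib]] .
qed (use Legendre_cases[of a r] Legendre_cases[of b r] Legendre_cases[of "a * b" r] in auto)

section \<open>Supplementary laws and quadratic reciprocity, with signs written as
  characters\<close>

definition chi4 :: "int \<Rightarrow> int" where
  "chi4 n = (if n mod 4 = 1 then 1 else -1)"

text \<open>The even character modulo 8. Like \<open>chi4\<close>, it is a character on odd
  integers; the value -1 at even integers is a default.\<close>

definition chi8 :: "int \<Rightarrow> int" where
  "chi8 n = (if n mod 8 = 1 \<or> n mod 8 = 7 then 1 else -1)"

lemma odd_mod_4: "odd (n::int) \<Longrightarrow> n mod 4 = 1 \<or> n mod 4 = 3"
  by presburger

lemma odd_mod_8: "odd (n::int) \<Longrightarrow> n mod 8 = 1 \<or> n mod 8 = 3 \<or> n mod 8 = 5 \<or> n mod 8 = 7"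
  by presburger

text \<open>Links the parity of the exponent in Euler's criterion and in reciprocity to the residue
  that \<open>chi4\<close> reads.\<close>

lemma odd_nat_mod_4:
  assumes "odd r"
  shows "(r mod 4 = 1 \<and> int r mod 4 = 1 \<and> even ((r - 1) div 2)) \<or>
    (r mod 4 = 3 \<and> int r mod 4 = 3 \<and> odd ((r - 1) div 2))"
proof -
  have "r mod 4 = 1 \<or> r mod 4 = 3" using assms by presburger
  moreover have "r mod 4 = 1 \<Longrightarrow> even ((r - 1) div 2)" "r mod 4 = 3 \<Longrightarrow> odd ((r - 1) div 2)"
    by presburger+
  moreover have "int r mod 4 = int (r mod 4)" by (simp add: zmod_int)
  ultimately show ?thesis by auto
qed

lemma chi4_mult:
  assumes "odd a" "odd b"
  shows "chi4 (a * b) = chi4 a * chi4 b"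
proof -
  have "a * b mod 4 = (a mod 4) * (b mod 4) mod 4" by (simp add: mod_mult_eq)
  then show ?thesis using odd_mod_4[OF assms(1)] odd_mod_4[OF assms(2)]
    by - (elim disjE; simp add: chi4_def)
qed

lemma chi8_mult:
  assumes "odd a" "odd b"
  shows "chi8 (a * b) = chi8 a * chi8 b"
proof -
  have "a * b mod 8 = (a mod 8) * (b mod 8) mod 8" by (simp add: mod_mult_eq)
  then show ?thesis using odd_mod_8[OF assms(1)] odd_mod_8[OF assms(2)]
    by - (elim disjE; simp add: chi8_def)
qed

lemma Legendre_minus_one:
  assumes "prime r" "odd r"
  shows "Legendre (-1) (int r) = chi4 (int r)"
proof (rule signs_cong_imp_eq)
  show r: "r > 2" by (rule prime_odd_gt_2[OF assms])
  have "(-1::int) ^ ((r - 1) div 2) = chi4 (int r)"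
    using odd_nat_mod_4[OF assms(2)] by (auto simp: chi4_def)
  then show "[Legendre (-1) (int r) = chi4 (int r)] (mod int r)"
    using euler_criterion[OF assms(1) r, of "-1"] by simp
qed (use Legendre_cases[of "-1" r] in \<open>auto simp: chi4_def\<close>)

text \<open>Gauss's lemma: the sign is determined by the number of multiples \<open>2 * x\<close>,
  with \<open>x\<close> from 1 to \<open>h\<close>, that exceed \<open>h\<close>.\<close>

lemma Legendre_two:
  assumes "prime r" "odd r"
  shows "Legendre 2 (int r) = chi8 (int r)"
proof -
  have r: "r > 2" by (rule prime_odd_gt_2[OF assms])
  interpret GAUSS r 2
    using assms(1) r by unfold_locales (auto simp: cong_0_iff dest: zdvd_imp_le)
  define h where "h = (int r - 1) div 2"
  have rh: "int r = 2 * h + 1" "h > 0" using assms(2) r by (auto simp: h_def elim!: oddE)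
  \<comment> \<open>Here \<open>2 * x \<le> 2 * h < r\<close>, so reduction modulo \<open>r\<close>
    changes nothing.\<close>
  have "C = (\<lambda>x. 2 * x) ` {0<..h}"
    unfolding C_def B_def A_def h_def[symmetric] image_image
    using rh by (intro image_cong) auto
  then have "E = (\<lambda>x. 2 * x) ` {h div 2<..h}"
    unfolding E_def h_def[symmetric] using rh(2) by auto
  then have "card E = nat (h - h div 2)"
    by (simp add: card_image inj_on_def)
  \<comment> \<open>Both sides depend on \<open>h\<close> modulo 4 only: they hold for residues 0
    and 3.\<close>
  moreover have "(int r mod 8 = 1 \<or> int r mod 8 = 7) \<longleftrightarrow> even (h - h div 2)"
    unfolding rh(1) by presburger
  moreover have "even (nat (h - h div 2)) \<longleftrightarrow> even (h - h div 2)"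
    using rh(2) by (subst even_nat_iff) auto
  ultimately show ?thesis
    unfolding gauss_lemma chi8_def by auto
qed

text \<open>The sign is arranged so that the left side is a character evaluated at \<open>r\<close>.
  The case \<open>q = r\<close>, where both symbols vanish, lets the identity hold at every odd
  prime \<open>r\<close>.\<close>

lemma Legendre_reciprocity:
  assumes "prime q" "odd q" "prime r" "odd r"
  shows "Legendre (int r) (int q) * (if q mod 4 = 3 then chi4 (int r) else 1) = Legendre (int q) (int r)"
proof (cases "q = r")
  case True
  then show ?thesis by (simp add: Legendre_def cong_0_iff)
next
  case False
  have "Legendre q r * Legendre r q = (-1::int) ^ ((q - 1) div 2 * ((r - 1) div 2))"
    using Quadratic_Reciprocity[of q r] assms False prime_odd_gt_2 by (simp add: mult.commute)
  also have "\<dots> = (if q mod 4 = 3 then chi4 (int r) else 1)"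
    using odd_nat_mod_4[OF assms(2)] odd_nat_mod_4[OF assms(4)] by (auto simp: chi4_def)
  finally show ?thesis
    using Legendre_cases[of q r] Legendre_cases[of r q] by (auto simp: chi4_def split: if_splits)
qed

subsection \<open>Quadratic characters\<close>

text \<open>For a character \<open>f\<close> that is given by Legendre symbols at the odd primes, the sign
  \<open>f (-1)\<close> is the contribution of the infinite place.\<close>

definition quadratic_character :: "int \<Rightarrow> (int \<Rightarrow> int) \<Rightarrow> bool" where
  "quadratic_character m f \<longleftrightarrow>
     (\<forall>a b. odd a \<longrightarrow> odd b \<longrightarrow> f (a * b) = f a * f b) \<and>
     (\<forall>a b. odd a \<longrightarrow> [a = b] (mod 4 * m) \<longrightarrow> f a = f b) \<and>
     (\<forall>r. prime r \<longrightarrow> odd r \<longrightarrow> f (int r) = Legendre m (int r))"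

lemma quadratic_character_multD:
  "quadratic_character m f \<Longrightarrow> odd a \<Longrightarrow> odd b \<Longrightarrow> f (a * b) = f a * f b"
  by (simp add: quadratic_character_def)

lemma quadratic_character_congD:
  "quadratic_character m f \<Longrightarrow> odd a \<Longrightarrow> [a = b] (mod 4 * m) \<Longrightarrow> f a = f b"
  by (auto simp: quadratic_character_def)

lemma quadratic_character_primeD:
  "quadratic_character m f \<Longrightarrow> prime r \<Longrightarrow> odd r \<Longrightarrow> f (int r) = Legendre m (int r)"
  by (simp add: quadratic_character_def)

lemma quadratic_character_mult:
  assumes "quadratic_character m f" "quadratic_character n g"
  shows "quadratic_character (m * n) (\<lambda>a. f a * g a)"
  unfolding quadratic_character_def
proof (intro conjI allI impI)
  fix a b :: int assume a: "odd a"
  assume ab: "[a = b] (mod 4 * (m * n))"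
  have "[a = b] (mod 4 * m)" "[a = b] (mod 4 * n)"
    by (rule cong_dvd_modulus[OF ab]; simp)+
  then show "f a * g a = f b * g b"
    using a assms quadratic_character_congD by metis
qed (use assms in \<open>auto simp: quadratic_character_def Legendre_mult\<close>)

lemma quadratic_character_minus_one: "quadratic_character (-1) chi4"
  by (auto simp: quadratic_character_def chi4_mult Legendre_minus_one)
     (simp add: chi4_def cong_def)

lemma quadratic_character_two: "quadratic_character 2 chi8"
  by (auto simp: quadratic_character_def chi8_mult Legendre_two)
     (simp add: chi8_def cong_def)

text \<open>Reciprocity makes the symbol of \<open>q\<close> at a prime \<open>r\<close> a function
  of \<open>r\<close> modulo \<open>4 * q\<close>: the Legendre factor has period \<open>q\<close>
  and the sign has period 4.\<close>

lemma quadratic_character_odd_prime: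
  assumes "prime q" "odd q"
  shows "quadratic_character (int q)
    (\<lambda>a. Legendre a (int q) * (if q mod 4 = 3 then chi4 a else 1))"
  unfolding quadratic_character_def
proof (intro conjI allI impI)
  fix a b :: int
  assume ab: "[a = b] (mod 4 * int q)"
  have "[a = b] (mod int q)" "[a = b] (mod 4)"
    by (rule cong_dvd_modulus[OF ab]; simp)+
  then show "Legendre a (int q) * (if q mod 4 = 3 then chi4 a else 1) =
      Legendre b (int q) * (if q mod 4 = 3 then chi4 b else 1)"
    using Legendre_cong[of a b "int q"] by (simp add: chi4_def cong_def)
qed (use assms in \<open>simp_all add: Legendre_mult chi4_mult Legendre_reciprocity\<close>)

text \<open>The product of the characters of the prime factors of \<open>m\<close>, taken with
  repetition, works, since each of them takes the value 1 at -1.\<close>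

lemma even_quadratic_character_exists:
  assumes "m > 0"
  shows "\<exists>f. quadratic_character (int m) f \<and> f (-1) = 1"
  using assms
proof (induction m rule: prime_divisors_induct)
  case (unit m)
  have "Legendre 1 (int r) = 1" if "prime r" for r
    using Legendre_square[of r 1] that by (auto simp: prime_nat_iff)
  then have "quadratic_character 1 (\<lambda>_. 1)"
    by (simp add: quadratic_character_def)
  then show ?case using unit by auto
next
  case (factor q m)
  then obtain f where f: "quadratic_character (int m) f" "f (-1) = 1" by auto
  obtain g where g: "quadratic_character (int q) g" "g (-1) = 1"
  proof (cases "q = 2")
    case True
    then show ?thesis using that[of chi8] quadratic_character_two by (simp add: chi8_def)
  next
    case False
    then have q: "prime q" "odd q" using factor.hyps by (auto dest: primes_dvd_imp_eq[OF two_is_prime_nat])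
    \<comment> \<open>For \<open>q\<close> congruent to 3 modulo 4 both factors are -1; otherwise
      both are 1.\<close>
    have "Legendre (-1) (int q) * (if q mod 4 = 3 then chi4 (-1) else 1) = 1"
      using Legendre_minus_one[OF q] odd_nat_mod_4[OF q(2)] by (auto simp: chi4_def)
    then show ?thesis using that quadratic_character_odd_prime[OF q] by blast
  qed
  show ?case
    using quadratic_character_mult[OF g(1) f(1)] f(2) g(2)
    by (intro exI[of _ "\<lambda>a. g a * f a"]) simp
qed simp

text \<open>Twisting the even character by \<open>chi4\<close>, the character of -1, flips its sign
  at -1.\<close>

lemma odd_quadratic_character_exists:
  assumes "m > 0"
  obtains f where "quadratic_character (- int m) f" "f (-1) = -1" "f 1 = 1"
proof -
  obtain g where g: "quadratic_character (int m) g" "g (-1) = 1"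
    using even_quadratic_character_exists[OF assms] by blast
  let ?f = "\<lambda>a. chi4 a * g a"
  have f: "quadratic_character (- int m) ?f"
    using quadratic_character_mult[OF quadratic_character_minus_one g(1)] by simp
  have f1: "?f (-1) = -1" using g(2) by (simp add: chi4_def)
  \<comment> \<open>The definition of a quadratic character leaves the value at 1 open; it follows
    from \<open>(-1) * (-1) = 1\<close>.\<close>
  have "?f 1 = ?f (-1) * ?f (-1)"
    using quadratic_character_multD[OF f, of "-1" "-1"] by simp
  then show ?thesis using that[OF f f1] f1 by simp
qed

section \<open>Evaluating quadratic characters through prime divisors and congruences\<close>

lemma quadratic_character_eq_1:
  assumes "quadratic_character m f" "f 1 = 1" "odd w"
    and "\<And>r. prime r \<Longrightarrow> r dvd w \<Longrightarrow> Legendre m (int r) = 1"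
  shows "f (int w) = 1"
  using assms(3,4)
proof (induction w rule: prime_divisors_induct)
  case (factor q w)
  then have "f (int q) = 1"
    using quadratic_character_primeD[OF assms(1)] by auto
  moreover have "f (int w) = 1" using factor by auto
  ultimately show ?case
    using quadratic_character_multD[OF assms(1), of "int q" "int w"] factor.prems by simp
qed (use assms(2) in auto)

text \<open>The equation says that \<open>p\<close> is congruent to \<open>- w\<close>, or
  \<open>p * w\<close> to -1, modulo \<open>4 * x * y\<close>. The odd character of
  \<open>- (x * y)\<close> is 1 at \<open>w\<close>, so its value at \<open>p\<close> is its value
  at -1.\<close>

lemma Legendre_minus_mult_eq_minus_one:
  fixes p w x y d :: nat
  assumes p: "prime p" "odd p" and xy: "coprime x y" "x > 0" "y > 0" and w: "w dvd x + y"
    and eq: "p + w = 4 * d * x * y \<or> p * w + 1 = 4 * d * x * y"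
  shows "Legendre (- (int x * int y)) (int p) = -1"
proof -
  have "2 dvd 4 * d * x * y" by simp
  then have "even (p + w) \<or> even (p * w + 1)"
    using eq by metis
  then have oddw: "odd w" using p(2) by auto
  have "x * y > 0" using xy by simp
  then obtain f where f: "quadratic_character (- (int x * int y)) f" "f (-1) = -1" "f 1 = 1"
    using odd_quadratic_character_exists by (metis of_nat_mult)
  have "f (int w) = 1"
  proof (rule quadratic_character_eq_1[OF f(1,3) oddw])
    fix r assume r: "prime r" "r dvd w"
    have "\<not> r dvd x"
    proof
      assume "r dvd x"
      moreover have "r dvd x + y" using r(2) w by (rule dvd_trans)
      ultimately have "r dvd y" by (simp add: dvd_add_right_iff)
      with \<open>r dvd x\<close> xy(1) r(1) show False
        by (meson coprime_common_divisor not_prime_unit)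
    qed
    then have "Legendre ((int x)\<^sup>2) (int r) = 1"
      using Legendre_square r(1) by simp
    \<comment> \<open>Modulo \<open>r\<close> the sum \<open>x + y\<close> vanishes, so
      \<open>- y\<close> may be replaced by \<open>x\<close>.\<close>
    moreover have "[- (int x * int y) = (int x)\<^sup>2] (mod int r)"
    proof -
      have "int r dvd int (x + y)" using r(2) w dvd_trans by (simp only: int_dvd_int_iff) blast
      moreover have "- (int x * int y) - (int x)\<^sup>2 = - int x * int (x + y)"
        by (simp add: power2_eq_square algebra_simps)
      ultimately show ?thesis
        unfolding cong_iff_dvd_diff by (simp only: dvd_mult)
    qed
    ultimately show "Legendre (- (int x * int y)) (int r) = 1"
      using Legendre_cong by metis
  qed
  moreover have "f (int p) * f (int w) = -1 \<or> f (int p) = - f (int w)"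
    using eq
  proof
    assume "p + w = 4 * d * x * y"
    then have "int (p + w) = int (4 * d * x * y)" by (simp only:)
    then have "int p + int w = 4 * int d * int x * int y" by simp
    then have "[int p = - int w] (mod 4 * (- (int x * int y)))"
      by (simp add: cong_iff_dvd_diff)
    then have "f (int p) = f (- int w)" using quadratic_character_congD[OF f(1)] p(2) by simp
    also have "\<dots> = - f (int w)"
      using quadratic_character_multD[OF f(1), of "-1" "int w"] oddw f(2) by simp
    finally show ?thesis by simp
  next
    assume "p * w + 1 = 4 * d * x * y"
    then have "int (p * w + 1) = int (4 * d * x * y)" by (simp only:)
    then have "int p * int w + 1 = 4 * int d * int x * int y" by simp
    then have "[int p * int w = -1] (mod 4 * (- (int x * int y)))"
      by (simp add: cong_iff_dvd_diff)
    then have "f (int p * int w) = -1"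
      using quadratic_character_congD[OF f(1), of "int p * int w" "-1"] p(2) oddw f(2) by simp
    then show ?thesis
      using quadratic_character_multD[OF f(1), of "int p" "int w"] oddw p(2) by simp
  qed
  ultimately show ?thesis
    using quadratic_character_primeD[OF f(1) p] by auto
qed

subsection \<open>The diophantine equation\<close>

text \<open>Repeated cancellation brings the equation into one of the two forms
  \<open>p + w = 4 * e * x * y\<close> and \<open>p * w + 1 = 4 * e * x * y\<close>.\<close>

lemma Legendre_minus_mult_of_solution:
  fixes p g x y c :: nat
  assumes p: "prime p" "odd p" and pos: "g > 0" "x > 0" "y > 0" "c > 0"
    and xy: "coprime x y" "\<not> p dvd x" "\<not> p dvd y"
    and eq: "4 * (g * x) * (g * y) * c = p * ((g * x) * (g * y) + (g * x) * c + (g * y) * c)"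
  shows "Legendre (- (int x * int y)) (int p) = -1"
proof -
  have p0: "p > 0" using p(1) by (rule prime_gt_0_nat)
  have cop: "coprime p x" "coprime p y" using p(1) xy by (simp_all add: prime_imp_coprime)
  have eq1: "4 * (g * x * y * c) = p * (g * x * y + c * (x + y))"
  proof -
    have "g * (4 * (g * x * y * c)) = g * (p * (g * x * y + c * (x + y)))"
      using eq by (simp add: algebra_simps)
    then show ?thesis using pos(1) by simp
  qed
  have "x * y dvd p * (g * x * y + c * (x + y))"
    unfolding eq1[symmetric] by simp
  then have "x * y dvd p * (g * (x * y)) + p * (x + y) * c"
    by (simp add: algebra_simps)
  then have "x * y dvd p * (x + y) * c"
    by (simp add: dvd_add_right_iff)
  \<comment> \<open>As \<open>x * y\<close> is coprime to \<open>p * (x + y)\<close>, it must divide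
    \<open>c\<close>.\<close>
  moreover have "coprime x (x + y)" "coprime y (x + y)"
    using xy(1) unfolding coprime_def by (metis dvd_add_right_iff dvd_add_left_iff)+
  then have "coprime (x * y) (p * (x + y))"
    using cop by (simp add: coprime_commute)
  ultimately have "x * y dvd c" by (simp add: coprime_dvd_mult_right_iff)
  then obtain c' where c: "c = x * y * c'" by blast
  define e where "e = gcd g c'"
  have e: "e > 0" using pos(1) by (simp add: e_def)
  obtain g1 c1 where g1: "g = e * g1" and c1: "c' = e * c1" and co: "coprime g1 c1"
    using gcd_coprime_exists[of g c'] e unfolding e_def by (metis mult.commute neq0_conv)
  \<comment> \<open>After substitution \<open>e * x * y\<close> is a common factor. What remains has
    \<open>g1\<close> and \<open>c1\<close> coprime, which forces \<open>c1\<close> to divide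
    \<open>p\<close>.\<close>
  have "e * x * y * (4 * (e * g1 * c1 * x * y)) = e * x * y * (p * (g1 + c1 * (x + y)))"
    using eq1 unfolding c g1 c1 by (simp add: algebra_simps)
  then have eq2: "4 * (e * g1 * c1 * x * y) = p * (g1 + c1 * (x + y))"
    using e pos by simp
  have g1_pos: "g1 > 0" using pos(1) g1 by simp
  have "c1 dvd p * (g1 + c1 * (x + y))" unfolding eq2[symmetric] by simp
  then have "c1 dvd p * g1 + c1 * (p * (x + y))" by (simp add: algebra_simps)
  then have "c1 dvd p * g1" by (simp add: dvd_add_left_iff)
  then have "c1 dvd p" using co by (simp add: coprime_commute coprime_dvd_mult_left_iff)
  then consider "c1 = 1" | "c1 = p" using p(1) by (auto simp: prime_nat_iff)
  then show ?thesis
  proof cases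
    case 1
    then have eq3: "4 * (e * g1 * x * y) = p * (g1 + x + y)" using eq2 by (simp add: algebra_simps)
    then have "p dvd 4 * (e * g1 * x * y)" by simp
    moreover have "\<not> p dvd 4"
    proof
      assume "p dvd 4"
      then have "p dvd 2 ^ 2" by simp
      then have "p dvd 2" using p(1) prime_dvd_power by blast
      then show False using p primes_dvd_imp_eq[OF p(1) two_is_prime_nat] by auto
    qed
    ultimately consider "p dvd g1" | "p dvd e" using p(1) xy by (auto simp: prime_dvd_mult_iff)
    then show ?thesis
    proof cases
      case 1
      then obtain h where h: "g1 = p * h" by blast
      have "p * (4 * (e * h * x * y)) = p * (p * h + (x + y))"
        using eq3 unfolding h by (simp add: algebra_simps)
      then have eq4: "4 * (e * h * x * y) = p * h + (x + y)" using p0 by simp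
      have "h dvd p * h + (x + y)" unfolding eq4[symmetric] by simp
      then have "h dvd x + y" by (simp add: dvd_add_right_iff)
      then obtain w where w: "x + y = h * w" by blast
      have "h * (p + w) = h * (4 * e * x * y)" using eq4 unfolding w by (simp add: algebra_simps)
      then have "p + w = 4 * e * x * y" using g1_pos h by simp
      moreover have "w dvd x + y" using w by simp
      ultimately show ?thesis
        using Legendre_minus_mult_eq_minus_one[OF p xy(1) pos(2,3)] by blast
    next
      case 2
      then obtain k where k: "e = p * k" by blast
      have "p * (4 * (k * g1 * x * y)) = p * (g1 + x + y)"
        using eq3 unfolding k by (simp add: algebra_simps)
      then have "4 * (k * g1 * x * y) = g1 + x + y" using p0 by simp
      \<comment> \<open>Each summand is at most \<open>k * g1 * x * y\<close>, so the sum is at most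
        three times this positive number.\<close>
      moreover have "g1 + x + y < 4 * (k * g1 * x * y)"
      proof -
        have "k > 0" using k e by simp
        then have "g1 \<le> k * g1 * x * y" "x \<le> k * g1 * x * y" "y \<le> k * g1 * x * y"
          using pos g1_pos by (simp_all add: Suc_leI)
        then show ?thesis using g1_pos by linarith
      qed
      ultimately show ?thesis by simp
    qed
  next
    case 2
    have "p * (4 * (e * g1 * x * y)) = p * (g1 + p * (x + y))"
      using eq2 unfolding 2 by (simp add: algebra_simps)
    then have eq3: "4 * (e * g1 * x * y) = g1 + p * (x + y)" using p0 by simp
    have "g1 dvd g1 + p * (x + y)" unfolding eq3[symmetric] by simp
    then have "g1 dvd p * (x + y)" by (simp add: dvd_add_right_iff)
    \<comment> \<open>Here \<open>c1 = p\<close>, so \<open>g1\<close> is coprime to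
      \<open>p\<close>.\<close>
    then have "g1 dvd x + y" using co 2 by (simp add: coprime_dvd_mult_right_iff)
    then obtain w where w: "x + y = g1 * w" by blast
    have "g1 * (p * w + 1) = g1 * (4 * e * x * y)"
      using eq3 unfolding w by (simp add: algebra_simps)
    then have "p * w + 1 = 4 * e * x * y" using g1_pos unfolding mult_cancel1 by simp
    moreover have "w dvd x + y" using w by simp
    ultimately show ?thesis
      using Legendre_minus_mult_eq_minus_one[OF p xy(1) pos(2,3)] by blast
  qed
qed

text \<open>With \<open>k\<close> and \<open>l\<close> the valuations of \<open>a\<close> and
  \<open>b\<close>, every term except \<open>p * a * b\<close> is divisible by
  \<open>p ^ (k + l + 2)\<close>, whereas \<open>p * a * b\<close> has valuation
  \<open>k + l + 1\<close>.\<close>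

lemma multiplicity_not_increasing:
  fixes a b c p :: nat
  assumes p: "prime p" and pos: "a > 0" "b > 0" "c > 0"
    and eq: "4 * a * b * c = p * (a * b + a * c + b * c)"
    and ab: "multiplicity p a < multiplicity p b" and bc: "multiplicity p b < multiplicity p c"
  shows False
proof -
  define k l where "k = multiplicity p a" and "l = multiplicity p b"
  have a: "p ^ k dvd a" and b: "p ^ l dvd b" "p ^ Suc k dvd b" and c: "p ^ Suc l dvd c"
    using ab bc by (simp_all add: k_def l_def multiplicity_dvd' Suc_leI del: power_Suc)
  \<comment> \<open>This supplies the middle factor \<open>p\<close> in the bound for
    \<open>4 * a * b * c\<close>.\<close>
  have pb: "p dvd b" using b(2) by (meson dvd_power dvd_trans zero_less_Suc)
  have "p ^ k * p * p ^ Suc l dvd a * (4 * b) * c"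
    using a pb c by (intro mult_dvd_mono) auto
  moreover have "p * p ^ k * p ^ Suc l dvd p * a * c" "p * p ^ Suc k * p ^ Suc l dvd p * b * c"
    using a b c by (intro mult_dvd_mono; simp)+
  ultimately have "p ^ Suc (Suc (k + l)) dvd 4 * a * b * c" "p ^ Suc (Suc (k + l)) dvd p * a * c + p * b * c"
    by (auto simp: power_add mult_ac intro!: dvd_add elim: dvd_trans[rotated])
  moreover have "4 * a * b * c = p * a * b + (p * a * c + p * b * c)"
    unfolding eq by (simp add: algebra_simps)
  ultimately have "p ^ Suc (Suc (k + l)) dvd p * a * b" by (metis dvd_add_left_iff)
  then have "p ^ Suc (k + l) dvd a * b" using p by (simp add: mult.assoc prime_gt_0_nat)
  then have "Suc (k + l) \<le> multiplicity p (a * b)"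
    using p pos by (intro multiplicity_geI) auto
  also have "\<dots> = k + l" using p pos by (simp add: k_def l_def prime_elem_multiplicity_mult_distrib)
  finally show False by simp
qed

subsection \<open>Units and quotients in the p-adic integers\<close>

lemma padic_int_nth_mod:
  assumes "x \<in> carrier (padic_int p)"
  shows "x (n + k) mod int p ^ n = x n"
proof (induction k)
  case 0
  then show ?case using assms by (auto simp: padic_int_def)
next
  case (Suc k)
  have "x (Suc (n + k)) mod int p ^ (n + k) = x (n + k)"
    using assms by (auto simp: padic_int_def)
  then have "x (n + k) mod int p ^ n = x (Suc (n + k)) mod int p ^ n"
    by (metis mod_mod_cancel le_imp_power_dvd le_add1)
  then show ?case using Suc by simp
qed

lemma padic_of_int_mult:
  "padic_of_int p (a * b) = padic_of_int p a \<otimes>\<^bsub>padic_int p\<^esub> padic_of_int p b"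
  by (simp add: padic_of_int_def padic_int_def mod_mult_eq)

lemma padic_int_Units_reduce:
  assumes "prime p" "x \<in> Units (padic_int p)"
  shows "\<not> int p dvd x 1"
proof
  assume "int p dvd x 1"
  obtain y where "x \<otimes>\<^bsub>padic_int p\<^esub> y = \<one>\<^bsub>padic_int p\<^esub>"
    using assms(2) by (auto simp: Units_def)
  then have "(x \<otimes>\<^bsub>padic_int p\<^esub> y) 1 = \<one>\<^bsub>padic_int p\<^esub> 1" by simp
  then have "x 1 * y 1 mod int p = 1 mod int p" by (simp add: padic_int_def)
  moreover have "x 1 * y 1 mod int p = 0" using \<open>int p dvd x 1\<close> by simp
  ultimately show False using prime_gt_1_nat[OF assms(1)] by simp
qed

text \<open>An inverse of \<open>b\<close> is chosen modulo each \<open>p ^ n\<close>. Inverses are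
  unique modulo \<open>p ^ n\<close>, so the choices form a coherent sequence.\<close>

lemma padic_of_int_Units:
  assumes "prime p" "\<not> int p dvd b"
  shows "padic_of_int p b \<in> Units (padic_int p)"
proof -
  interpret cring "padic_int p"
    using padic_int_cring prime_gt_0_nat[OF assms(1)] by blast
  have p: "p > 0" "prime (int p)" using assms(1) prime_gt_0_nat by auto
  have cop: "coprime b (int p ^ n)" for n
    using prime_imp_coprime[OF p(2) assms(2)] by (simp add: coprime_commute)
  have "\<exists>i. [b * i = 1] (mod int p ^ n)" for n
    using cop by (rule cong_solve_coprime_int)
  then obtain i where i: "\<And>n. [b * i n = 1] (mod int p ^ n)" by metis
  define y where "y = (\<lambda>n. i n mod int p ^ n)"
  have "i (Suc n) mod int p ^ n = i n mod int p ^ n" for n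
  proof -
    have "[b * i (Suc n) = 1] (mod int p ^ n)"
      by (rule cong_dvd_modulus[OF i]) simp
    then have "[b * i (Suc n) = b * i n] (mod int p ^ n)"
      using i cong_sym cong_trans by blast
    then have "[i (Suc n) = i n] (mod int p ^ n)"
      using cop by (simp add: cong_mult_lcancel)
    then show ?thesis by (simp add: cong_def)
  qed
  then have "y \<in> carrier (padic_int p)"
    using p padic_int_mod_Suc[of _ p] by (simp add: y_def padic_int_def del: power_Suc)
  moreover have "padic_of_int p b \<otimes>\<^bsub>padic_int p\<^esub> y = \<one>\<^bsub>padic_int p\<^esub>"
    using i by (simp add: padic_int_def padic_of_int_def y_def mod_mult_eq cong_def)
  ultimately show ?thesis
    using padic_of_int_carrier[OF p(1)] m_comm by (auto simp: Units_def)
qed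

text \<open>After the common power of \<open>p\<close> is cancelled, numerator and denominator are
  both units.\<close>

lemma padic_unit_quotient_exists:
  assumes p: "prime p" and pos: "a > 0" "b > 0" and m: "multiplicity p a = multiplicity p b"
  shows "\<exists>x\<in>Units (padic_int p). padic_is_quotient p x (int a) (int b)"
proof -
  interpret cring "padic_int p"
    using padic_int_cring prime_gt_0_nat[OF p] by blast
  define v where "v = multiplicity p a"
  obtain a' b' where a: "a = p ^ v * a'" "\<not> p dvd a'" and b: "b = p ^ v * b'" "\<not> p dvd b'"
    using multiplicity_decompose'[of a p] multiplicity_decompose'[of b p] pos m p v_def
    by (metis not_prime_unit less_numeral_extra(3))
  let ?i = "\<lambda>k. padic_of_int p (int k)"
  have U: "?i a' \<in> Units (padic_int p)" "?i b' \<in> Units (padic_int p)"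
    using a(2) b(2) p by (simp_all add: padic_of_int_Units)
  have C: "?i k \<in> carrier (padic_int p)" for k
    using padic_of_int_carrier prime_gt_0_nat[OF p] by blast
  let ?x = "?i a' \<otimes>\<^bsub>padic_int p\<^esub> inv\<^bsub>padic_int p\<^esub> ?i b'"
  have "?i b' \<otimes>\<^bsub>padic_int p\<^esub> ?x = ?i a'"
    using U C by (simp add: m_lcomm Units_r_inv)
  then have "?i b \<otimes>\<^bsub>padic_int p\<^esub> ?x = ?i a"
    using U C by (simp add: a(1) b(1) padic_of_int_mult m_assoc del: of_nat_power)
  moreover have "?x \<in> Units (padic_int p)" using U by simp
  ultimately show ?thesis
    unfolding padic_is_quotient_def using Units_closed by blast
qed

lemma padic_is_quotient_reduce:
  assumes p: "prime p" and x: "padic_is_quotient p x (g * a) (g * b)" and "g \<noteq> 0"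
  shows "[b * x 1 = a] (mod int p)"
proof -
  \<comment> \<open>Cancelling \<open>g\<close> loses as many \<open>p\<close>-adic digits as its
    valuation; one further digit leaves a congruence modulo \<open>p\<close>.\<close>
  define n where "n = Suc (multiplicity (int p) g)"
  have C: "x \<in> carrier (padic_int p)"
    and "padic_of_int p (g * b) \<otimes>\<^bsub>padic_int p\<^esub> x = padic_of_int p (g * a)"
    using x by (auto simp: padic_is_quotient_def)
  then have "(padic_of_int p (g * b) \<otimes>\<^bsub>padic_int p\<^esub> x) n = padic_of_int p (g * a) n" by simp
  then have "(g * b * x n) mod int p ^ n = (g * a) mod int p ^ n"
    by (simp add: padic_int_def padic_of_int_def mod_mult_left_eq)
  then have dvd: "int p ^ n dvd g * (b * x n - a)"
    by (simp add: mod_eq_dvd_iff right_diff_distrib mult.assoc)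
  have "int p dvd b * x n - a"
  proof (rule ccontr)
    assume "\<not> int p dvd b * x n - a"
    then have "coprime (int p ^ n) (b * x n - a)"
      using p by (simp add: prime_imp_coprime)
    then have "int p ^ n dvd g" using dvd by (simp add: coprime_dvd_mult_left_iff)
    then have "n \<le> multiplicity (int p) g"
      using p \<open>g \<noteq> 0\<close> by (intro multiplicity_geI) (auto simp: prime_gt_1_nat)
    then show False by (simp add: n_def)
  qed
  moreover have "[x n = x 1] (mod int p)"
    using padic_int_nth_mod[OF C, of 1 "n - 1"] unfolding cong_def n_def
    by (metis diff_Suc_1 mod_mod_trivial plus_1_eq_Suc power_one_right)
  ultimately show ?thesis
    by (metis cong_iff_dvd_diff cong_scalar_left cong_sym cong_trans)
qed

text \<open>The ring negation is given abstractly as an additive inverse, so its residue is read off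
  from the sum at level 1.\<close>

lemma padic_reduce_a_inv:
  assumes "prime p" "x \<in> carrier (padic_int p)"
  shows "[padic_reduce (\<ominus>\<^bsub>padic_int p\<^esub> x) = - x 1] (mod int p)"
proof -
  interpret cring "padic_int p"
    using padic_int_cring prime_gt_0_nat[OF assms(1)] by blast
  have "\<ominus>\<^bsub>padic_int p\<^esub> x \<oplus>\<^bsub>padic_int p\<^esub> x = \<zero>\<^bsub>padic_int p\<^esub>"
    using assms(2) by (rule l_neg)
  then have "(\<ominus>\<^bsub>padic_int p\<^esub> x \<oplus>\<^bsub>padic_int p\<^esub> x) 1 = \<zero>\<^bsub>padic_int p\<^esub> 1" by simp
  then have "(padic_reduce (\<ominus>\<^bsub>padic_int p\<^esub> x) + x 1) mod int p = 0"
    by (simp add: padic_int_def padic_reduce_def)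
  then show ?thesis
    unfolding cong_iff_dvd_diff by (auto dest: mod_0_imp_dvd)
qed

text \<open>In lowest terms the quotient is \<open>y / z\<close>, and \<open>- x\<close> differs
  from \<open>- (y * z)\<close> modulo \<open>p\<close> by the square factor
  \<open>z ^ 2\<close>.\<close>

lemma Legendre_padic_quotient:
  fixes a b c p :: nat
  assumes p: "prime p" "odd p" and pos: "a > 0" "b > 0" "c > 0"
    and eq: "4 * a * b * c = p * (a * b + a * c + b * c)"
    and x: "x \<in> Units (padic_int p)" "padic_is_quotient p x (int a) (int b)"
  shows "Legendre (padic_reduce (\<ominus>\<^bsub>padic_int p\<^esub> x)) (int p) = -1"
proof -
  interpret cring "padic_int p"
    using padic_int_cring prime_gt_0_nat[OF p(1)] by blast
  define g where "g = gcd a b"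
  have g: "g > 0" using pos by (simp add: g_def)
  obtain y z where a: "a = g * y" and b: "b = g * z" and co: "coprime y z"
    using gcd_coprime_exists[of a b] g unfolding g_def by (metis mult.commute neq0_conv)
  have cong: "[int z * x 1 = int y] (mod int p)"
    using padic_is_quotient_reduce[OF p(1), of x "int g" "int y" "int z"] x(2) g a b by simp
  have px: "\<not> int p dvd x 1" by (rule padic_int_Units_reduce[OF p(1) x(1)])
  have "int p dvd int z * x 1 \<longleftrightarrow> int p dvd int y"
    using cong by (rule cong_dvd_iff)
  \<comment> \<open>Since \<open>x\<close> is a unit, \<open>p\<close> divides both of
    \<open>y\<close> and \<open>z\<close> or neither; coprimality excludes both.\<close>
  then have "p dvd z \<longleftrightarrow> p dvd y"
    using px p(1) by (simp add: prime_dvd_mult_iff)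
  moreover have "\<not> (p dvd y \<and> p dvd z)"
    using co p(1) by (meson coprime_common_divisor not_prime_unit)
  ultimately have pyz: "\<not> p dvd y" "\<not> p dvd z" by auto
  have "Legendre (- (int y * int z)) (int p) = -1"
    using Legendre_minus_mult_of_solution[OF p g _ _ pos(3) co pyz] pos eq unfolding a b by simp
  also have "Legendre (- (int y * int z)) (int p) = Legendre (- x 1 * (int z)\<^sup>2) (int p)"
  proof (rule Legendre_cong)
    have "[- (int z) * int y = - (int z) * (int z * x 1)] (mod int p)"
      using cong by (intro cong_scalar_left) (rule cong_sym)
    then show "[- (int y * int z) = - x 1 * (int z)\<^sup>2] (mod int p)"
      by (simp add: power2_eq_square mult_ac)
  qed
  also have "\<dots> = Legendre (- x 1) (int p)"
    unfolding Legendre_mult[OF p] using Legendre_square[OF p(1), of "int z"] pyz(2) by simp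
  also have "\<dots> = Legendre (padic_reduce (\<ominus>\<^bsub>padic_int p\<^esub> x)) (int p)"
    using padic_reduce_a_inv[OF p(1)] x(1) by (intro Legendre_cong cong_sym[OF padic_reduce_a_inv[OF p(1)]]) auto
  finally show ?thesis .
qed

theorem corollary1p3:
  fixes p :: nat and u :: "nat \<Rightarrow> nat"
  assumes "prime p" and "odd p"
    and "\<forall>i\<in>{1,2,3}. u i > 0"
    and "4 / (of_nat p :: rat) = 1 / of_nat (u 1) + 1 / of_nat (u 2) + 1 / of_nat (u 3)"
  shows "(\<exists>i\<in>{1,2,3}. \<exists>j\<in>{1,2,3}. i \<noteq> j \<and>
            (\<exists>x\<in>Units (padic_int p). padic_is_quotient p x (int (u i)) (int (u j)))) \<and>
         (\<forall>i\<in>{1,2,3}. \<forall>j\<in>{1,2,3}. i \<noteq> j \<longrightarrow>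
            (\<forall>x\<in>Units (padic_int p). padic_is_quotient p x (int (u i)) (int (u j)) \<longrightarrow>
               Legendre (padic_reduce (\<ominus>\<^bsub>padic_int p\<^esub> x)) (int p) = -1))"
proof (intro conjI ballI impI)
  have pos: "u 1 > 0" "u 2 > 0" "u 3 > 0" using assms(3) by auto
  have "(of_nat (4 * u 1 * u 2 * u 3) :: rat) = of_nat (p * (u 1 * u 2 + u 1 * u 3 + u 2 * u 3))"
    using assms(4) pos prime_gt_0_nat[OF assms(1)] by (simp add: field_simps)
  then have eq: "4 * u 1 * u 2 * u 3 = p * (u 1 * u 2 + u 1 * u 3 + u 2 * u 3)"
    by (simp only: of_nat_eq_iff)
  \<comment> \<open>The equation is symmetric, so it may be used with the indices in any
    order.\<close>
  have eqs: "4 * u i * u j * u k = p * (u i * u j + u i * u k + u j * u k)"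
    if "i \<in> {1,2,3}" "j \<in> {1,2,3}" "k \<in> {1,2,3}" "i \<noteq> j" "i \<noteq> k" "j \<noteq> k" for i j k
    using that eq by (auto simp: algebra_simps)
  show "\<exists>i\<in>{1,2,3}. \<exists>j\<in>{1,2,3}. i \<noteq> j \<and>
      (\<exists>x\<in>Units (padic_int p). padic_is_quotient p x (int (u i)) (int (u j)))"
  proof (rule ccontr)
    define v where "v = (\<lambda>i. multiplicity p (u i))"
    assume no: "\<not> ?thesis"
    have neq: "v i \<noteq> v j" if "i \<in> {1,2,3}" "j \<in> {1,2,3}" "i \<noteq> j" for i j
    proof
      assume "v i = v j"
      moreover have "u i > 0" "u j > 0" using that assms(3) by blast+
      ultimately have "\<exists>x\<in>Units (padic_int p). padic_is_quotient p x (int (u i)) (int (u j))"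
        unfolding v_def by (intro padic_unit_quotient_exists[OF assms(1)])
      with that have "\<exists>i\<in>{1,2,3}. \<exists>j\<in>{1,2,3}. i \<noteq> j \<and>
          (\<exists>x\<in>Units (padic_int p). padic_is_quotient p x (int (u i)) (int (u j)))"
        by (intro bexI[of _ i] bexI[of _ j] conjI)
      with no show False by contradiction
    qed
    have mono: "\<not> (v i < v j \<and> v j < v k)"
      if "i \<in> {1,2,3}" "j \<in> {1,2,3}" "k \<in> {1,2,3}" "i \<noteq> j" "i \<noteq> k" "j \<noteq> k" for i j k
    proof -
      have "u i > 0" "u j > 0" "u k > 0" using that assms(3) by blast+
      then show ?thesis
        using multiplicity_not_increasing[OF assms(1) _ _ _ eqs[OF that]] unfolding v_def by blast
    qed
    \<comment> \<open>Three distinct valuations are strictly increasing in one of the six orders of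
      the indices.\<close>
    show False
      using neq[of 1 2] neq[of 1 3] neq[of 2 3] mono[of 1 2 3] mono[of 1 3 2] mono[of 2 1 3]
        mono[of 2 3 1] mono[of 3 1 2] mono[of 3 2 1] by simp linarith
  qed
  fix i j x
  assume ij: "i \<in> {1,2,3}" "j \<in> {1,2,3}" "i \<noteq> j"
    and x: "x \<in> Units (padic_int p)" "padic_is_quotient p x (int (u i)) (int (u j))"
  have "\<exists>k\<in>{1,2,3}. i \<noteq> k \<and> j \<noteq> k"
    using ij by (elim insertE emptyE) simp_all
  then obtain k where k: "k \<in> {1,2,3}" "i \<noteq> k" "j \<noteq> k" by blast
  have "u i > 0" "u j > 0" "u k > 0" using assms(3) ij k by blast+
  then show "Legendre (padic_reduce (\<ominus>\<^bsub>padic_int p\<^esub> x)) (int p) = -1"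
    by (rule Legendre_padic_quotient[OF assms(1,2) _ _ _ eqs[OF ij(1,2) k(1) ij(3) k(2,3)] x])
qed

end
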